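(* Let $\alpha$ be a real number and let $n$ be a positive integer. Then $$s(n,1,\alpha)=n!\sum_{k=0}^{n-1}(-1)^{n-k-1}\frac{\binom{-\alpha}{k}}{n-k}.$$
   Context: For a real number $x$ and a nonnegative integer $k$, $\binom{x}{k}=\frac{x(x-1)\cdots(x-k+1)}{k!}$ is the generalized binomial coefficient, with $\binom{x}{0}=1$. $s(n,i,\alpha)$ denotes the non-central Stirling numbers of the first kind, for $0\le i\le n$ and $\alpha\in\mathbb R$. They are given by $s(0,0,\alpha)=1$ and, for every integer $n\ge 0$, $$s(n+1,0,\alpha)=(-\alpha-n)\,s(n,0,\alpha),$$ $$s(n+1,i,\alpha)=(-\alpha-n)\,s(n,i,\alpha)+s(n,i-1,\alpha)\quad(i=1,\ldots,n),$$ $$s(n+1,n+1,\alpha)=s(n,n,\alpha).$$ *)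

theory Defs
  imports Complex_Main
begin

text \<open>
  Non-central Stirling numbers of the first kind \<open>s(n, i, \<alpha>)\<close>. They are meant for \<open>i \<le> n\<close>; here they
  are extended by \<open>0\<close> to \<open>i > n\<close>, so that the general recurrence also covers the diagonal case
  \<open>s(n + 1, n + 1, \<alpha>) = s(n, n, \<alpha>)\<close>.
\<close>

fun nc_stirling1 :: "nat \<Rightarrow> nat \<Rightarrow> real \<Rightarrow> real" where
  "nc_stirling1 0 0 \<alpha> = 1"
| "nc_stirling1 0 (Suc i) \<alpha> = 0"
| "nc_stirling1 (Suc n) 0 \<alpha> = (- \<alpha> - real n) * nc_stirling1 n 0 \<alpha>"
| "nc_stirling1 (Suc n) (Suc i) \<alpha> =
     (- \<alpha> - real n) * nc_stirling1 n (Suc i) \<alpha> + nc_stirling1 n i \<alpha>"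

lemma nc_stirling1_eq_0: "n < i \<Longrightarrow> nc_stirling1 n i \<alpha> = 0"
  by (induction n i \<alpha> rule: nc_stirling1.induct) auto

lemma nc_stirling1_rec:
  assumes "1 \<le> i" "i \<le> n"
  shows "nc_stirling1 (n + 1) i \<alpha> =
           (- \<alpha> - real n) * nc_stirling1 n i \<alpha> + nc_stirling1 n (i - 1) \<alpha>"
  using assms by (cases i) auto

lemma nc_stirling1_diag: "nc_stirling1 (n + 1) (n + 1) \<alpha> = nc_stirling1 n n \<alpha>"
  by (simp add: nc_stirling1_eq_0)

end

theory Submission
  imports Defs
begin

text \<open>
  The numbers \<open>s(n, 1, \<alpha>) / n!\<close> are the derivatives of \<open>x \<mapsto> x gchoose n\<close> at \<open>x = - \<alpha>\<close>, and the sum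
  is the coefficient of \<open>t ^ n\<close> in \<open>(1 + t) powr x * ln (1 + t)\<close>. Both sides satisfy the same
  first-order recurrence in \<open>n\<close>. For the sum it follows from \<open>(n + 1) / (n + 1 - k) = 1 + k / (n + 1 - k)\<close>
  and the absorption identity \<open>k (x gchoose k) = (x - k + 1) (x gchoose (k - 1))\<close>.
\<close>

text \<open>Column 0 is the falling factorial of \<open>- \<alpha>\<close>: each step of the
  recurrence contributes its next factor. It supplies the inhomogeneous term in the recurrence for
  column 1.\<close>

lemma nc_stirling1_0: "nc_stirling1 n 0 \<alpha> = fact n * ((- \<alpha>) gchoose n)"
proof (induction n)
  case (Suc n)
  have "(- \<alpha> - real n) * ((- \<alpha>) gchoose n) = real (Suc n) * ((- \<alpha>) gchoose Suc n)"
    using gbinomial_absorb_comp[of "- \<alpha>" n] gbinomial_absorption[of n "- \<alpha>"] by simp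
  then have "nc_stirling1 (Suc n) 0 \<alpha> = fact n * (real (Suc n) * ((- \<alpha>) gchoose Suc n))"
    using Suc by (simp only: nc_stirling1.simps mult.left_commute)
  then show ?case
    by (simp del: nc_stirling1.simps)
qed simp

definition gchoose_log_sum :: "real \<Rightarrow> nat \<Rightarrow> real" where
  "gchoose_log_sum x n = (\<Sum>k<n. (- 1) ^ (n - k - 1) * ((x gchoose k) / real (n - k)))"

lemma gchoose_log_sum_Suc:
  "real (Suc n) * gchoose_log_sum x (Suc n) = (x - real n) * gchoose_log_sum x n + (x gchoose n)"
proof -
  \<comment> \<open>Numerator of the \<open>k\<close>-th term of the sum for \<open>Suc n\<close>,
    since \<open>Suc n - k - 1 = n - k\<close>.\<close>
  define c where "c k = (- 1) ^ (n - k) * (x gchoose k)" for k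
  have "real (Suc n) * gchoose_log_sum x (Suc n)
      = (\<Sum>k<Suc n. c k + real k * (c k / real (Suc n - k)))"
    unfolding gchoose_log_sum_def c_def sum_distrib_left
    by (intro sum.cong refl) (auto simp: field_simps of_nat_diff)
  \<comment> \<open>The factor \<open>real k\<close> kills the term at 0, so the second sum can be
    shifted by one. \<open>c n\<close> is split off because it equals
    \<open>x gchoose n\<close>.\<close>
  also have "\<dots> = (\<Sum>k<n. c k) + c n + (\<Sum>k<n. real (Suc k) * (c (Suc k) / real (n - k)))"
    by (simp only: sum.distrib sum.lessThan_Suc_shift[of "\<lambda>k. real k * (c k / real (Suc n - k))"])
      simp
  also have "(\<Sum>k<n. real (Suc k) * (c (Suc k) / real (n - k)))
      = (\<Sum>k<n. (x - real n) * ((- 1) ^ (n - k - 1) * ((x gchoose k) / real (n - k))) - c k)"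
  proof (intro sum.cong refl)
    fix k assume "k \<in> {..<n}"
    then have k: "k < n" by simp
    have absorb: "real (Suc k) * (x gchoose Suc k) = (x - real k) * (x gchoose k)"
      using gbinomial_absorb_comp[of x k] gbinomial_absorption[of k x] by simp
    have "real (Suc k) * (c (Suc k) / real (n - k))
        = (- 1) ^ (n - k - 1) * ((real (Suc k) * (x gchoose Suc k)) / real (n - k))"
      by (simp add: c_def)
    \<comment> \<open>Writing \<open>x - k\<close> as \<open>(x - n) + (n - k)\<close> makes the
      second part cancel the denominator; what remains of it is \<open>- c k\<close>, which later
      removes the sum of the \<open>c k\<close>.\<close>
    also have "\<dots> = (- 1) ^ (n - k - 1) * (((x - real n) + real (n - k)) * (x gchoose k) / real (n - k))"
      using k by (simp only: absorb) (simp add: of_nat_diff)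
    also have "\<dots> = (x - real n) * ((- 1) ^ (n - k - 1) * ((x gchoose k) / real (n - k)))
        + (- 1) ^ (n - k - 1) * (x gchoose k)"
      using k by (simp add: field_simps del: of_nat_diff)
    also have "(- 1) ^ (n - k - 1) * (x gchoose k) = - c k"
      using k power_Suc[of "- 1 :: real" "n - k - 1"] by (simp add: c_def Suc_diff_Suc)
    finally show "real (Suc k) * (c (Suc k) / real (n - k))
        = (x - real n) * ((- 1) ^ (n - k - 1) * ((x gchoose k) / real (n - k))) - c k"
      by simp
  qed
  also have "\<dots> = (x - real n) * gchoose_log_sum x n - (\<Sum>k<n. c k)"
    by (simp add: gchoose_log_sum_def sum_subtractf sum_distrib_left)
  finally show ?thesis
    by (simp add: c_def)
qed

lemma nc_stirling1_1: "nc_stirling1 n 1 \<alpha> = fact n * gchoose_log_sum (- \<alpha>) n"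
proof (induction n)
  case 0
  then show ?case by (simp add: gchoose_log_sum_def)
next
  case (Suc n)
  have "nc_stirling1 (Suc n) 1 \<alpha>
      = fact n * ((- \<alpha> - real n) * gchoose_log_sum (- \<alpha>) n + ((- \<alpha>) gchoose n))"
    using Suc by (simp add: nc_stirling1_0 algebra_simps)
  also have "\<dots> = fact (Suc n) * gchoose_log_sum (- \<alpha>) (Suc n)"
    by (simp only: gchoose_log_sum_Suc[symmetric]) simp
  finally show ?case .
qed

theorem corollary1:
  fixes \<alpha> :: real and n :: nat
  assumes "n \<ge> 1"
  shows "nc_stirling1 n 1 \<alpha> =
    fact n * (\<Sum>k = 0..n - 1. (- 1) ^ (n - k - 1) * (((- \<alpha>) gchoose k) / real (n - k)))"
proof -
  \<comment> \<open>For \<open>n = 0\<close> truncated subtraction would give \<open>{0}\<close> on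
    the left and the empty set on the right.\<close>
  have "{0..n - 1} = {..<n}"
    using assms by auto
  then show ?thesis
    by (simp only: nc_stirling1_1 gchoose_log_sum_def)
qed

end
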